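(* Let $n\ge1$. For any polynomial $f\in\mathcal{H}_{n,3}$ and any integer $r\ge 2$, one has $$\max_{x\in\Delta_n}\{B_r(f)(x)-f(x)\}\le\left(\frac{4}{r}-\frac{4}{r^2}\right)(\overline{f}-\underline{f}).$$
   Context: $\mathbb{N}=\{0,1,2,\dots\}$. $\mathcal{H}_{n,d}$ is the set of homogeneous polynomials of degree $d$ in $n$ variables with real coefficients. The standard simplex is $\Delta_n=\{x\in\mathbb{R}_+^n:\sum_{i=1}^n x_i=1\}$; $\underline{f}=\min_{x\in\Delta_n}f(x)$ and $\overline{f}=\max_{x\in\Delta_n}f(x)$. For $r\ge 0$, $I(n,r)=\{\alpha\in\mathbb{N}^n:\sum_{i=1}^n\alpha_i=r\}$. For $\alpha\in\mathbb{N}^n$, $\alpha!=\prod_{i=1}^n\alpha_i!$ and $x^\alpha=\prod_{i=1}^n x_i^{\alpha_i}$ (with $0^0=1$). The Bernstein approximation of order $r\ge1$ on the simplex of a polynomial $f$ is the polynomial $$B_r(f)(x)=\sum_{\alpha\in I(n,r)}f\left(\frac{\alpha}{r}\right)\frac{r!}{\alpha!}x^\alpha.$$ *)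

theory Defs
  imports "HOL-Analysis.Analysis" "HOL-Library.Poly_Mapping"
begin

(* Multi-indices are vectors nat^'n, and a real polynomial in CARD('n) variables is the
   finitely supported family of its coefficients. *)
type_synonym 'n real_mpoly = "(nat ^ 'n) \<Rightarrow>\<^sub>0 real"

definition multi_indices :: "nat \<Rightarrow> (nat ^ 'n) set" where
  "multi_indices r = {\<alpha>. (\<Sum>i\<in>UNIV. \<alpha> $ i) = r}"

definition multi_fact :: "nat ^ 'n \<Rightarrow> nat" where
  "multi_fact \<alpha> = (\<Prod>i\<in>UNIV. fact (\<alpha> $ i))"

definition monomial_at :: "real ^ 'n \<Rightarrow> nat ^ 'n \<Rightarrow> real" where
  "monomial_at x \<alpha> = (\<Prod>i\<in>UNIV. (x $ i) ^ (\<alpha> $ i))"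

definition poly_at :: "'n::finite real_mpoly \<Rightarrow> real ^ 'n \<Rightarrow> real" where
  "poly_at f x = (\<Sum>\<alpha>\<in>Poly_Mapping.keys f. Poly_Mapping.lookup f \<alpha> * monomial_at x \<alpha>)"

(* Contains the zero polynomial for every d. *)
definition homogeneous_polys :: "nat \<Rightarrow> 'n::finite real_mpoly set" where
  "homogeneous_polys d = {f. Poly_Mapping.keys f \<subseteq> multi_indices d}"

definition std_simplex :: "(real ^ 'n) set" where
  "std_simplex = {x. (\<forall>i. 0 \<le> x $ i) \<and> (\<Sum>i\<in>UNIV. x $ i) = 1}"

definition bernstein :: "nat \<Rightarrow> 'n::finite real_mpoly \<Rightarrow> real ^ 'n \<Rightarrow> real" where
  "bernstein r f x =
    (\<Sum>\<alpha>\<in>multi_indices r.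
      poly_at f (\<chi> i. real (\<alpha> $ i) / real r) * (fact r / real (multi_fact \<alpha>)) * monomial_at x \<alpha>)"

(* Greatest and Least are unspecified when no extremum exists; simplex_max_attained and
   simplex_min_attained show that this does not happen for continuous g. *)
definition simplex_max :: "(real ^ 'n \<Rightarrow> real) \<Rightarrow> real" where
  "simplex_max g = (GREATEST v. v \<in> g ` std_simplex)"

definition simplex_min :: "(real ^ 'n \<Rightarrow> real) \<Rightarrow> real" where
  "simplex_min g = (LEAST v. v \<in> g ` std_simplex)"

(* In particular the sum in bernstein is never the default value of an infinite sum. *)
lemma finite_multi_indices: "finite (multi_indices r :: (nat ^ 'n) set)"
proof -
  have "multi_indices r \<subseteq> (\<lambda>h. \<chi> i. h i) ` (PiE (UNIV :: 'n set) (\<lambda>_. {..r}))"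
  proof
    fix \<alpha> :: "nat ^ 'n" assume "\<alpha> \<in> multi_indices r"
    then have s: "(\<Sum>i\<in>UNIV. \<alpha> $ i) = r" by (simp add: multi_indices_def)
    have "\<alpha> $ i \<le> r" for i
      using member_le_sum[of i UNIV "\<lambda>i. \<alpha> $ i"] s by simp
    then have "($) \<alpha> \<in> PiE UNIV (\<lambda>_. {..r})" by (simp add: PiE_UNIV_domain)
    moreover have "\<alpha> = (\<chi> i. \<alpha> $ i)" by simp
    ultimately show "\<alpha> \<in> (\<lambda>h. \<chi> i. h i) ` (PiE UNIV (\<lambda>_. {..r}))" by blast
  qed
  moreover have "finite (PiE (UNIV :: 'n set) (\<lambda>_. {..r}))"
    by (rule finite_PiE) auto
  ultimately show ?thesis
    by (meson finite_imageI finite_subset)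
qed

lemma std_simplex_nonempty: "(std_simplex :: (real ^ 'n) set) \<noteq> {}"
proof -
  have "axis undefined 1 \<in> (std_simplex :: (real ^ 'n) set)"
    by (simp add: std_simplex_def axis_def)
  then show ?thesis by blast
qed

lemma compact_std_simplex: "compact (std_simplex :: (real ^ 'n) set)"
proof -
  have "std_simplex = (\<Inter>i. {x :: real ^ 'n. 0 \<le> x $ i}) \<inter> {x. (\<Sum>i\<in>UNIV. x $ i) = 1}"
    by (auto simp: std_simplex_def)
  moreover have "closed ((\<Inter>i. {x :: real ^ 'n. 0 \<le> x $ i}) \<inter> {x. (\<Sum>i\<in>UNIV. x $ i) = 1})"
    by (intro closed_Int closed_INT ballI closed_Collect_le closed_Collect_eq continuous_intros)
  ultimately have "closed (std_simplex :: (real ^ 'n) set)" by simp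
  moreover have "norm x \<le> 1" if "x \<in> std_simplex" for x :: "real ^ 'n"
    using norm_le_l1_cart[of x] that by (simp add: std_simplex_def)
  ultimately show ?thesis
    by (auto simp: compact_eq_bounded_closed bounded_iff)
qed

lemma continuous_on_monomial_at: "continuous_on S (\<lambda>x. monomial_at x \<alpha>)"
  unfolding monomial_at_def by (intro continuous_intros)

lemma continuous_on_poly_at: "continuous_on S (poly_at f)"
  unfolding poly_at_def by (intro continuous_intros continuous_on_monomial_at)

lemma continuous_on_bernstein: "continuous_on S (bernstein r f)"
  unfolding bernstein_def by (intro continuous_intros continuous_on_monomial_at)

lemma simplex_max_attained:
  assumes "continuous_on std_simplex g"
  shows "\<exists>x\<in>std_simplex. g x = simplex_max g \<and> (\<forall>y\<in>std_simplex. g y \<le> simplex_max g)"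
proof -
  obtain x where x: "x \<in> std_simplex" "\<forall>y\<in>std_simplex. g y \<le> g x"
    using continuous_attains_sup[OF compact_std_simplex std_simplex_nonempty assms] by blast
  then have "simplex_max g = g x"
    unfolding simplex_max_def by (intro Greatest_equality) auto
  with x show ?thesis by auto
qed

lemma simplex_min_attained:
  assumes "continuous_on std_simplex g"
  shows "\<exists>x\<in>std_simplex. g x = simplex_min g \<and> (\<forall>y\<in>std_simplex. simplex_min g \<le> g y)"
proof -
  obtain x where x: "x \<in> std_simplex" "\<forall>y\<in>std_simplex. g x \<le> g y"
    using continuous_attains_inf[OF compact_std_simplex std_simplex_nonempty assms] by blast
  then have "simplex_min g = g x"
    unfolding simplex_min_def by (intro Least_equality) auto
  with x show ?thesis by auto
qed

end

theory Submission
  imports Defs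
begin

text \<open>
  Let \<open>\<alpha>\<close> be multinomially distributed with \<open>r\<close> trials and cell probabilities
  \<open>x \<in> std_simplex\<close>. Then \<open>B\<^sub>r(f)(x)\<close> is the expectation of \<open>f(\<alpha>/r)\<close>, so every \<open>B\<^sub>r(f)(x)\<close> with
  \<open>r \<ge> 1\<close> lies between the minimum and the maximum of \<open>f\<close> on the simplex
  (\<open>bernstein_bounds\<close>).

  For cubic \<open>f\<close> the third moments of \<open>\<alpha>\<close> have the form \<open>r(r-1)(r-2) A + r(r-1) Q + r L\<close>
  with \<open>A\<close>, \<open>Q\<close>, \<open>L\<close> independent of \<open>r\<close> and \<open>A = f(x)\<close>. Hence
  \<open>r\<^sup>2 B\<^sub>r(f)(x) = (r-1)(r-2) f(x) + (r-1) Q + L\<close>, and the unknowns \<open>Q\<close> and \<open>L\<close> can be eliminated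
  by means of the orders one and two, where \<open>B\<^sub>1 = L\<close> and \<open>4 B\<^sub>2 = Q + L\<close>. This gives
  \<open>r\<^sup>2 B\<^sub>r(f) = 4(r-1) B\<^sub>2(f) - (r-2) B\<^sub>1(f) + (r-1)(r-2) f\<close> on the simplex
  (\<open>bernstein_cubic_interpolation\<close>), that is,
  \<open>r\<^sup>2 (B\<^sub>r(f) - f) = 4(r-1) B\<^sub>2(f) - (r-2) B\<^sub>1(f) - (3r-2) f\<close>.
  For \<open>r \<ge> 2\<close> the coefficients of \<open>B\<^sub>1(f)\<close> and \<open>f\<close> are nonpositive and add up to \<open>-4(r-1)\<close>.
  Bounding \<open>B\<^sub>2(f)\<close> by the maximum of \<open>f\<close>, and \<open>B\<^sub>1(f)\<close> and \<open>f\<close> by its minimum, yields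
  the claim after division by \<open>r\<^sup>2\<close>.
\<close>

section \<open>Multi-indices and unit vectors\<close>

lemma multi_indices_add_unit:
  fixes \<gamma> :: "nat ^ 'n::finite"
  shows "\<gamma> + axis i 1 \<in> multi_indices (Suc d) \<longleftrightarrow> \<gamma> \<in> multi_indices d"
  by (simp add: multi_indices_def sum.distrib axis_def)

lemma add_unit_diff_unit:
  fixes \<alpha> :: "nat ^ 'n::finite"
  assumes "\<alpha> $ i \<noteq> 0"
  shows "(\<alpha> - axis i 1) + axis i 1 = \<alpha>"
  using assms by (auto simp: vec_eq_iff axis_def)

lemma monomial_at_add_unit: "monomial_at x (\<gamma> + axis i 1) = x $ i * monomial_at x \<gamma>"
proof -
  have "monomial_at x (\<gamma> + axis i 1) = monomial_at x \<gamma> * (\<Prod>j\<in>UNIV. if j = i then x $ j else 1)"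
    unfolding monomial_at_def prod.distrib[symmetric]
    by (intro prod.cong) (auto simp: axis_def)
  then show ?thesis by simp
qed

lemma multi_fact_add_unit: "multi_fact (\<gamma> + axis i 1) = Suc (\<gamma> $ i) * multi_fact \<gamma>"
proof -
  have "multi_fact (\<gamma> + axis i 1) = multi_fact \<gamma> * (\<Prod>j\<in>UNIV. if j = i then Suc (\<gamma> $ j) else 1)"
    unfolding multi_fact_def prod.distrib[symmetric]
    by (intro prod.cong) (auto simp: axis_def)
  then show ?thesis by simp
qed

lemma multi_indices_0: "multi_indices 0 = {0 :: nat ^ 'n::finite}"
  by (auto simp: multi_indices_def vec_eq_iff)

lemma monomial_at_0: "monomial_at x 0 = 1"
  by (simp add: monomial_at_def)

lemma multi_indices_SucE:
  fixes \<alpha> :: "nat ^ 'n::finite"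
  assumes "\<alpha> \<in> multi_indices (Suc d)"
  obtains i \<gamma> where "\<gamma> \<in> multi_indices d" "\<alpha> = \<gamma> + axis i 1"
proof -
  have "(\<Sum>i\<in>UNIV. \<alpha> $ i) \<noteq> 0" using assms by (simp add: multi_indices_def)
  then obtain i where "\<alpha> $ i \<noteq> 0" by (auto simp: sum_eq_0_iff)
  then have "\<alpha> = (\<alpha> - axis i 1) + axis i 1" by (simp only: add_unit_diff_unit not_False_eq_True)
  moreover from this have "\<alpha> - axis i 1 \<in> multi_indices d"
    using assms multi_indices_add_unit by metis
  ultimately show thesis by (rule that[rotated])
qed

lemma monomial_at_cubic:
  fixes \<beta> :: "nat ^ 'n::finite"
  assumes "\<beta> \<in> multi_indices 3"
  obtains i j k where "\<And>x. monomial_at x \<beta> = x $ i * x $ j * x $ k"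
proof -
  have "\<beta> \<in> multi_indices (Suc (Suc (Suc 0)))" using assms by (simp add: numeral_3_eq_3)
  then obtain i j k where "\<beta> = 0 + axis k 1 + axis j 1 + axis i 1"
    by (metis multi_indices_SucE multi_indices_0 singletonD)
  then have "monomial_at x \<beta> = x $ i * x $ j * x $ k" for x
    by (simp only: monomial_at_add_unit monomial_at_0 mult_1_right mult.assoc)
  then show thesis by (rule that)
qed

section \<open>Moments of the multinomial distribution\<close>

text \<open>
  The weights are the probabilities of the multinomial distribution with \<open>r\<close> trials and cell
  probabilities \<open>x\<close>.
\<close>
definition multinomial_mean :: "nat \<Rightarrow> real ^ 'n::finite \<Rightarrow> (nat ^ 'n \<Rightarrow> real) \<Rightarrow> real" where
  "multinomial_mean r x g =
    (\<Sum>\<alpha>\<in>multi_indices r. fact r / real (multi_fact \<alpha>) * monomial_at x \<alpha> * g \<alpha>)"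

lemma multinomial_mean_add:
  "multinomial_mean r x (\<lambda>\<alpha>. g \<alpha> + h \<alpha>) = multinomial_mean r x g + multinomial_mean r x h"
  by (simp add: multinomial_mean_def distrib_left sum.distrib)

lemma multinomial_mean_cmult:
  "multinomial_mean r x (\<lambda>\<alpha>. c * g \<alpha>) = c * multinomial_mean r x g"
  by (simp add: multinomial_mean_def sum_distrib_left mult_ac)

lemma multinomial_mean_sum:
  "multinomial_mean r x (\<lambda>\<alpha>. \<Sum>b\<in>B. g b \<alpha>) = (\<Sum>b\<in>B. multinomial_mean r x (g b))"
  unfolding multinomial_mean_def sum_distrib_left by (rule sum.swap)

lemma multinomial_mean_mono:
  fixes x :: "real ^ 'n::finite"
  assumes "x \<in> std_simplex" "\<And>\<alpha>. \<alpha> \<in> multi_indices r \<Longrightarrow> g \<alpha> \<le> h \<alpha>"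
  shows "multinomial_mean r x g \<le> multinomial_mean r x h"
  unfolding multinomial_mean_def
proof (intro sum_mono mult_left_mono assms(2))
  fix \<alpha> :: "nat ^ 'n"
  have "0 \<le> monomial_at x \<alpha>"
    using assms(1) by (auto simp: monomial_at_def std_simplex_def intro!: prod_nonneg)
  then show "0 \<le> fact r / real (multi_fact \<alpha>) * monomial_at x \<alpha>" by simp
qed

text \<open>
  A factor \<open>\<alpha>\<^sub>i\<close> cancels against \<open>\<alpha>!\<close>, which removes one trial: the sum may be
  reindexed by \<open>\<alpha> = \<gamma> + e\<^sub>i\<close>. All moments follow from this recursion.
\<close>
lemma multinomial_mean_count:
  "multinomial_mean (Suc r) x (\<lambda>\<alpha>. real (\<alpha> $ i) * g \<alpha>)
    = real (Suc r) * x $ i * multinomial_mean r x (\<lambda>\<gamma>. g (\<gamma> + axis i 1))"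
proof -
  let ?w = "\<lambda>\<alpha>. fact (Suc r) / real (multi_fact \<alpha>) * monomial_at x \<alpha> * (real (\<alpha> $ i) * g \<alpha>)"
  let ?up = "\<lambda>\<gamma> :: nat ^ 'a. \<gamma> + axis i 1"
  have image: "?up ` multi_indices r = {\<alpha> \<in> multi_indices (Suc r). \<alpha> $ i \<noteq> 0}"
  proof (intro equalityI subsetI)
    fix \<alpha> assume "\<alpha> \<in> ?up ` multi_indices r"
    then obtain \<gamma> where "\<gamma> \<in> multi_indices r" "\<alpha> = ?up \<gamma>" by blast
    moreover have "?up \<gamma> $ i \<noteq> 0" by (simp add: axis_def)
    ultimately show "\<alpha> \<in> {\<alpha> \<in> multi_indices (Suc r). \<alpha> $ i \<noteq> 0}"
      by (simp only: multi_indices_add_unit mem_Collect_eq simp_thms)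
  next
    fix \<alpha> :: "nat ^ 'a" assume a: "\<alpha> \<in> {\<alpha> \<in> multi_indices (Suc r). \<alpha> $ i \<noteq> 0}"
    then have eq: "\<alpha> = ?up (\<alpha> - axis i 1)"
      by (simp only: add_unit_diff_unit mem_Collect_eq not_False_eq_True)
    with a have "\<alpha> - axis i 1 \<in> multi_indices r"
      by (metis (no_types, lifting) mem_Collect_eq multi_indices_add_unit)
    with eq show "\<alpha> \<in> ?up ` multi_indices r" by (rule image_eqI)
  qed
  have inj: "inj_on ?up (multi_indices r)"
    by (auto simp: inj_on_def)
  have "multinomial_mean (Suc r) x (\<lambda>\<alpha>. real (\<alpha> $ i) * g \<alpha>) = sum ?w (?up ` multi_indices r)"
    unfolding multinomial_mean_def image
    by (rule sum.mono_neutral_right) (auto simp: finite_multi_indices)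
  also have "\<dots> = (\<Sum>\<gamma>\<in>multi_indices r. ?w (?up \<gamma>))"
    using sum.reindex[OF inj, of ?w] by (simp add: o_def)
  also have "\<dots> = real (Suc r) * x $ i * multinomial_mean r x (\<lambda>\<gamma>. g (\<gamma> + axis i 1))"
    unfolding multinomial_mean_def sum_distrib_left
  proof (rule sum.cong[OF refl])
    fix \<gamma> :: "nat ^ 'a"
    have "(\<gamma> + axis i 1) $ i = Suc (\<gamma> $ i)" by (simp add: axis_def)
    moreover have "real (multi_fact \<gamma>) \<noteq> 0" by (simp add: multi_fact_def)
    ultimately show "?w (?up \<gamma>) = real (Suc r) * x $ i *
        (fact r / real (multi_fact \<gamma>) * monomial_at x \<gamma> * g (\<gamma> + axis i 1))"
      unfolding multi_fact_add_unit monomial_at_add_unit fact_Suc of_nat_mult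
      by (simp add: divide_simps del: of_nat_Suc mult_Suc)
  qed
  finally show ?thesis .
qed

text \<open>
  Summing the recursion for the constant function \<open>1\<close> over \<open>i\<close> shows that the total mass does not
  depend on \<open>r\<close>, because \<open>\<Sum>\<alpha>\<^sub>i = r + 1\<close> and \<open>\<Sum>x\<^sub>i = 1\<close>.
\<close>
lemma multinomial_mean_1:
  assumes "x \<in> std_simplex"
  shows "multinomial_mean r x (\<lambda>_. 1) = 1"
proof (induction r)
  case 0
  show ?case
    by (simp add: multinomial_mean_def multi_indices_0 monomial_at_0 multi_fact_def)
next
  case (Suc r)
  have "real (Suc r) * multinomial_mean (Suc r) x (\<lambda>_. 1)
      = multinomial_mean (Suc r) x (\<lambda>\<alpha>. \<Sum>i\<in>UNIV. real (\<alpha> $ i) * 1)"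
    unfolding multinomial_mean_cmult[symmetric] unfolding multinomial_mean_def
    by (rule sum.cong) (auto simp: multi_indices_def simp flip: of_nat_sum)
  also have "\<dots> = (\<Sum>i\<in>UNIV. real (Suc r) * x $ i)"
    unfolding multinomial_mean_sum multinomial_mean_count by (simp add: Suc.IH)
  also have "\<dots> = real (Suc r)"
    using assms by (simp add: std_simplex_def flip: sum_distrib_left)
  finally show ?case by simp
qed

lemma multinomial_mean_const:
  assumes "x \<in> std_simplex"
  shows "multinomial_mean r x (\<lambda>_. c) = c"
  using multinomial_mean_cmult[of r x c "\<lambda>_. 1"] multinomial_mean_1[OF assms, of r] by simp

lemma multinomial_moment_1:
  assumes "x \<in> std_simplex"
  shows "multinomial_mean r x (\<lambda>\<alpha>. real (\<alpha> $ i)) = real r * x $ i"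
proof (cases r)
  case 0
  then show ?thesis by (simp add: multinomial_mean_def multi_indices_0)
next
  case (Suc s)
  then show ?thesis
    using multinomial_mean_count[of s x i "\<lambda>_. 1"] by (simp add: multinomial_mean_1[OF assms])
qed

text \<open>
  Removing a trial with outcome \<open>i\<close> shifts \<open>\<alpha>\<^sub>j\<close> by one exactly if \<open>i = j\<close>; such coincidences
  of indices produce the lower-order terms here and in the third moment.
\<close>
lemma multinomial_moment_2:
  assumes "x \<in> std_simplex"
  shows "multinomial_mean r x (\<lambda>\<alpha>. real (\<alpha> $ i) * real (\<alpha> $ j))
    = real r * (real r - 1) * (x $ i * x $ j) + real r * (of_bool (i = j) * x $ i)"
proof (cases r)
  case 0
  then show ?thesis by (simp add: multinomial_mean_def multi_indices_0)
next
  case (Suc s)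
  have "multinomial_mean s x (\<lambda>\<gamma>. real ((\<gamma> + axis i 1) $ j))
      = multinomial_mean s x (\<lambda>\<gamma>. real (\<gamma> $ j) + of_bool (i = j))"
    by (rule arg_cong[where f = "multinomial_mean s x"]) (auto simp: axis_def fun_eq_iff)
  also have "\<dots> = real s * x $ j + of_bool (i = j)"
    by (simp only: multinomial_mean_add multinomial_mean_const[OF assms]
        multinomial_moment_1[OF assms])
  finally show ?thesis
    unfolding Suc multinomial_mean_count by (simp add: algebra_simps)
qed

lemma multinomial_moment_3:
  assumes "x \<in> std_simplex"
  shows "multinomial_mean r x (\<lambda>\<alpha>. real (\<alpha> $ i) * (real (\<alpha> $ j) * real (\<alpha> $ k)))
    = real r * (real r - 1) * (real r - 2) * (x $ i * x $ j * x $ k)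
      + real r * (real r - 1) * (of_bool (i = j) * (x $ i * x $ k)
          + of_bool (i = k) * (x $ i * x $ j) + of_bool (j = k) * (x $ i * x $ j))
      + real r * (of_bool (i = j \<and> i = k) * x $ i)"
proof (cases r)
  case 0
  then show ?thesis by (simp add: multinomial_mean_def multi_indices_0)
next
  case (Suc s)
  have "multinomial_mean s x (\<lambda>\<gamma>. real ((\<gamma> + axis i 1) $ j) * real ((\<gamma> + axis i 1) $ k))
      = multinomial_mean s x (\<lambda>\<gamma>. real (\<gamma> $ j) * real (\<gamma> $ k) + of_bool (i = j) * real (\<gamma> $ k)
          + of_bool (i = k) * real (\<gamma> $ j) + of_bool (i = j \<and> i = k))"
    by (rule arg_cong[where f = "multinomial_mean s x"])
      (auto simp: axis_def fun_eq_iff algebra_simps)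
  also have "\<dots> = real s * (real s - 1) * (x $ j * x $ k) + real s * (of_bool (j = k) * x $ j)
      + of_bool (i = j) * (real s * x $ k) + of_bool (i = k) * (real s * x $ j)
      + of_bool (i = j \<and> i = k)"
    by (simp only: multinomial_mean_add multinomial_mean_cmult multinomial_mean_const[OF assms]
        multinomial_moment_1[OF assms] multinomial_moment_2[OF assms])
  finally have shifted:
    "multinomial_mean s x (\<lambda>\<gamma>. real ((\<gamma> + axis i 1) $ j) * real ((\<gamma> + axis i 1) $ k)) = \<dots>" .
  show ?thesis
    unfolding Suc multinomial_mean_count shifted by (simp add: algebra_simps)
qed

section \<open>Bernstein approximation as an expectation\<close>

lemma bernstein_eq_multinomial_mean:
  "bernstein r f x = multinomial_mean r x (\<lambda>\<alpha>. poly_at f (\<chi> i. real (\<alpha> $ i) / real r))"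
  by (simp add: bernstein_def multinomial_mean_def mult_ac)

text \<open>The sample points \<open>\<alpha>/r\<close> lie in the simplex, and a mean lies between the extreme values.\<close>
lemma bernstein_bounds:
  assumes "x \<in> std_simplex" "r \<ge> 1"
  shows "simplex_min (poly_at f) \<le> bernstein r f x" "bernstein r f x \<le> simplex_max (poly_at f)"
proof -
  have grid: "(\<chi> i. real (\<alpha> $ i) / real r) \<in> std_simplex" if "\<alpha> \<in> multi_indices r" for \<alpha> :: "nat ^ 'a"
    using that assms(2)
    by (auto simp: std_simplex_def multi_indices_def simp flip: sum_divide_distrib of_nat_sum)
  have "simplex_min (poly_at f) = multinomial_mean r x (\<lambda>_. simplex_min (poly_at f))"
    by (simp add: multinomial_mean_const[OF assms(1)])
  also have "\<dots> \<le> bernstein r f x"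
    unfolding bernstein_eq_multinomial_mean
    using simplex_min_attained[OF continuous_on_poly_at[of _ f]] grid
    by (intro multinomial_mean_mono[OF assms(1)]) blast
  finally show "simplex_min (poly_at f) \<le> bernstein r f x" .
  have "bernstein r f x \<le> multinomial_mean r x (\<lambda>_. simplex_max (poly_at f))"
    unfolding bernstein_eq_multinomial_mean
    using simplex_max_attained[OF continuous_on_poly_at[of _ f]] grid
    by (intro multinomial_mean_mono[OF assms(1)]) blast
  then show "bernstein r f x \<le> simplex_max (poly_at f)"
    by (simp add: multinomial_mean_const[OF assms(1)])
qed

section \<open>Interpolation in the order, and the error bound\<close>

text \<open>
  On a cubic monomial, \<open>r\<^sup>2 B\<^sub>r\<close> is a polynomial in \<open>r\<close> of degree at most two whose leading
  coefficient is the monomial itself, so its values at \<open>r = 1\<close> and \<open>r = 2\<close> determine it.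
\<close>
lemma multinomial_mean_cubic_monomial:
  fixes \<beta> :: "nat ^ 'n::finite"
  assumes "x \<in> std_simplex" "\<beta> \<in> multi_indices 3" "r \<ge> 1"
  defines "b \<equiv> \<lambda>s. multinomial_mean s x (\<lambda>\<alpha>. monomial_at (\<chi> i. real (\<alpha> $ i) / real s) \<beta>)"
  shows "(real r)\<^sup>2 * b r = 4 * (real r - 1) * b 2 - (real r - 2) * b 1
    + (real r - 1) * (real r - 2) * monomial_at x \<beta>"
proof -
  obtain i j k where ijk: "\<And>x. monomial_at x \<beta> = x $ i * x $ j * x $ k"
    using monomial_at_cubic[OF assms(2)] by metis
  define Q where "Q = of_bool (i = j) * (x $ i * x $ k)
      + of_bool (i = k) * (x $ i * x $ j) + of_bool (j = k) * (x $ i * x $ j)"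
  define L where "L = of_bool (i = j \<and> i = k) * x $ i"
  have b: "(real s)\<^sup>2 * b s
      = (real s - 1) * (real s - 2) * monomial_at x \<beta> + (real s - 1) * Q + L" if "s \<ge> 1" for s
  proof -
    have "b s = (1 / real s ^ 3) *
        multinomial_mean s x (\<lambda>\<alpha>. real (\<alpha> $ i) * (real (\<alpha> $ j) * real (\<alpha> $ k)))"
      unfolding b_def ijk multinomial_mean_cmult[symmetric]
      by (simp add: power3_eq_cube mult_ac)
    also have "\<dots> = (1 / real s ^ 3) * (real s *
        ((real s - 1) * (real s - 2) * monomial_at x \<beta> + (real s - 1) * Q + L))"
      unfolding multinomial_moment_3[OF assms(1)] ijk Q_def L_def
      by (simp only: distrib_left mult.assoc mult.left_commute)
    finally show ?thesis using that by (simp add: power2_eq_square power3_eq_cube)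
  qed
  have L: "L = b 1" and Q: "Q = 4 * b 2 - b 1"
    using b[of 1] b[of 2] by auto
  show ?thesis
    unfolding b[OF assms(3)] L Q by (simp add: algebra_simps)
qed

lemma bernstein_cubic_interpolation:
  assumes "f \<in> homogeneous_polys 3" "x \<in> std_simplex" "r \<ge> 1"
  shows "(real r)\<^sup>2 * bernstein r f x = 4 * (real r - 1) * bernstein 2 f x
    - (real r - 2) * bernstein 1 f x + (real r - 1) * (real r - 2) * poly_at f x"
proof -
  let ?b = "\<lambda>s \<beta>. multinomial_mean s x (\<lambda>\<alpha>. monomial_at (\<chi> i. real (\<alpha> $ i) / real s) \<beta>)"
  let ?c = "Poly_Mapping.lookup f" and ?K = "Poly_Mapping.keys f"
  have bern: "bernstein s f x = (\<Sum>\<beta>\<in>?K. ?c \<beta> * ?b s \<beta>)" for s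
    unfolding bernstein_eq_multinomial_mean poly_at_def multinomial_mean_sum multinomial_mean_cmult ..
  have "(real r)\<^sup>2 * bernstein r f x = (\<Sum>\<beta>\<in>?K. ?c \<beta> * ((real r)\<^sup>2 * ?b r \<beta>))"
    by (simp add: bern sum_distrib_left mult_ac)
  also have "\<dots> = (\<Sum>\<beta>\<in>?K. ?c \<beta> * (4 * (real r - 1) * ?b 2 \<beta> - (real r - 2) * ?b 1 \<beta>
      + (real r - 1) * (real r - 2) * monomial_at x \<beta>))"
  proof (rule sum.cong[OF refl])
    fix \<beta> assume "\<beta> \<in> ?K"
    with assms(1) have "\<beta> \<in> multi_indices 3" by (auto simp: homogeneous_polys_def)
    from multinomial_mean_cubic_monomial[OF assms(2) this assms(3)]
    show "?c \<beta> * ((real r)\<^sup>2 * ?b r \<beta>) = ?c \<beta> * (4 * (real r - 1) * ?b 2 \<beta> - (real r - 2) * ?b 1 \<beta>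
      + (real r - 1) * (real r - 2) * monomial_at x \<beta>)"
      by simp
  qed
  also have "\<dots> = 4 * (real r - 1) * bernstein 2 f x
    - (real r - 2) * bernstein 1 f x + (real r - 1) * (real r - 2) * poly_at f x"
    unfolding bern poly_at_def sum_distrib_left sum_subtractf[symmetric] sum.distrib[symmetric]
    by (rule sum.cong[OF refl]) (simp only: algebra_simps)
  finally show ?thesis .
qed

theorem theorem5:
  fixes f :: "'n::finite real_mpoly" and r :: nat
  assumes "f \<in> homogeneous_polys 3" and "r \<ge> 2"
  shows "simplex_max (\<lambda>x. bernstein r f x - poly_at f x)
    \<le> (4 / real r - 4 / (real r)\<^sup>2) * (simplex_max (poly_at f) - simplex_min (poly_at f))"
proof -
  let ?R = "real r" and ?M = "simplex_max (poly_at f)" and ?m = "simplex_min (poly_at f)"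
  have r: "?R \<ge> 2" using assms(2) by simp
  have "continuous_on std_simplex (\<lambda>x. bernstein r f x - poly_at f x)"
    by (intro continuous_on_diff continuous_on_bernstein continuous_on_poly_at)
  from simplex_max_attained[OF this] obtain x where x: "x \<in> std_simplex"
    and max: "bernstein r f x - poly_at f x = simplex_max (\<lambda>x. bernstein r f x - poly_at f x)"
    by blast
  have "?R\<^sup>2 * (bernstein r f x - poly_at f x)
      = 4 * (?R - 1) * bernstein 2 f x - (?R - 2) * bernstein 1 f x - (3 * ?R - 2) * poly_at f x"
    using bernstein_cubic_interpolation[OF assms(1) x, of r] assms(2)
    by (simp add: algebra_simps power2_eq_square)
  also have "\<dots> \<le> 4 * (?R - 1) * ?M - (?R - 2) * ?m - (3 * ?R - 2) * ?m"
  proof (intro diff_mono mult_left_mono)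
    show "bernstein 2 f x \<le> ?M" "?m \<le> bernstein 1 f x"
      by (simp_all add: bernstein_bounds[OF x])
    show "?m \<le> poly_at f x"
      using simplex_min_attained[OF continuous_on_poly_at[of _ f]] x by blast
  qed (use r in auto)
  also have "\<dots> = ?R\<^sup>2 * ((4 / ?R - 4 / ?R\<^sup>2) * (?M - ?m))"
    using r by (simp add: field_simps power2_eq_square)
  finally show ?thesis
    using r unfolding max by simp
qed

end
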